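(* Let $n\ge 2$ and let $\mathcal{P}$ be a regular $n$-crosspolytope inscribed in a unit $n$-sphere. Let $V$ be the number of vertices and $F$ the number of facets of $\mathcal{P}$, let $N$ be the total number of chords of $\mathcal{P}$, and let $c_1,\dots,c_N$ be the lengths of these chords (one entry for each chord). Then $$\prod_{i=1}^{N}c_i^2=F^V .$$
   Context: A unit $n$-sphere is a sphere of radius $1$ in $\mathbb{R}^n$ (so a "2-sphere" is a circle). A regular polytope is inscribed in it if all vertices lie on the sphere, whose center is the center of the polytope. The regular $n$-crosspolytope is the regular convex polytope in $\mathbb{R}^n$ that is the convex hull of the $2n$ points lying at a common distance from a point $\mathbf{O}$ on $n$ mutually orthogonal lines through $\mathbf{O}$ (for $n=2$ the square, for $n=3$ the octahedron). Facets are $(n-1)$-dimensional faces. A chord is a line segment whose endpoints are two distinct vertices of the polytope (so chords are all edges and all diagonals). *)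

theory Defs
  imports "HOL-Analysis.Analysis"
begin

(* The directions d in D are nonzero and pairwise orthogonal, so the lines through ctr and
   ctr + d are CARD('n) distinct, mutually orthogonal lines through ctr. Each of them carries
   exactly two points at distance r from ctr. The point ctr is the center of P. *)
definition regular_crosspolytope :: "real^'n \<Rightarrow> (real^'n) set \<Rightarrow> bool" where
  "regular_crosspolytope ctr P \<longleftrightarrow>
    (\<exists>D r. card D = CARD('n) \<and> 0 \<notin> D \<and> pairwise orthogonal D \<and> r > 0 \<and>
      P = convex hull {x. dist ctr x = r \<and> (\<exists>d\<in>D. x \<in> affine hull {ctr, ctr + d})})"

definition vertices :: "'a::euclidean_space set \<Rightarrow> 'a set" where
  "vertices P = {v. v extreme_point_of P}"

definition facets :: "'a::euclidean_space set \<Rightarrow> 'a set set" where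
  "facets P = {f. f facet_of P}"

(* A chord is the segment itself, so the pairs (u, v) and (v, u) give one chord. *)
definition chords :: "'a::euclidean_space set \<Rightarrow> 'a set set" where
  "chords P = {closed_segment u v | u v. u \<in> vertices P \<and> v \<in> vertices P \<and> u \<noteq> v}"

definition segment_length :: "'a::euclidean_space set \<Rightarrow> real" where
  "segment_length s = (THE l. \<exists>u v. s = closed_segment u v \<and> l = dist u v)"

lemma segment_length_closed_segment [simp]: "segment_length (closed_segment u v) = dist u v"
  unfolding segment_length_def
proof (rule the_equality)
  fix l assume "\<exists>a b. closed_segment u v = closed_segment a b \<and> l = dist a b"
  then obtain a b where "closed_segment u v = closed_segment a b" "l = dist a b" by blast
  then show "l = dist u v"
    by (auto simp: doubleton_eq_iff dist_commute)
qed blast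

end

theory Submission
  imports Defs
begin

text \<open>
  Let \<open>V = 2n\<close> be the number of vertices and fix one of them. One other vertex is antipodal to it,
  at squared distance \<open>4\<close>; the remaining \<open>2n - 2\<close> lie, seen from the center, in directions
  orthogonal to it, hence at squared distance \<open>2\<close>. Their product is \<open>4 \<cdot> 2 ^ (2n - 2) = (2 ^ n)\<^sup>2\<close>. Multiplying over all
  vertices counts every chord twice, so the square of the required product is \<open>((2 ^ n) ^ V)\<^sup>2\<close>.
  It remains to see that there are exactly \<open>2 ^ n\<close> facets.

  In orthonormal coordinates the crosspolytope is the unit ball of the \<open>\<ell>\<^sup>1\<close>-norm, and
  \<open>\<Sum>\<bar>y\<^sub>i\<bar> \<le> 1\<close> says that \<open>w \<bullet> y \<le> 1\<close> for all \<open>2 ^ n\<close> sign vectors \<open>w\<close>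
  (\<open>convex_hull_cross_points_eq\<close>). No two of these half-spaces coincide and none of them can be
  left out: distinct sign vectors satisfy \<open>w \<bullet> w' \<le> n - 2\<close>, while \<open>w \<bullet> w = n\<close>, so a suitable
  multiple of \<open>w\<close> violates the inequality of \<open>w\<close> and no other. The facets of a polyhedron
  correspond to the half-spaces of an irredundant description, which gives the count
  (\<open>card_facets_cross\<close>).
\<close>

section \<open>Orthonormal bases and sign vectors\<close>

locale orthonormal_basis =
  fixes B :: "'a::euclidean_space set"
  assumes card_B: "card B = DIM('a)"
    and orth_B: "pairwise orthogonal B"
    and norm_B: "b \<in> B \<Longrightarrow> norm b = 1"
begin

lemma finite_B [simp]: "finite B"
  using card_B card.infinite by fastforce

lemma B_nonempty: "B \<noteq> {}"
  using card_B by force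

lemma inner_B: "b \<in> B \<Longrightarrow> b' \<in> B \<Longrightarrow> b \<bullet> b' = (if b = b' then 1 else 0)"
  using orth_B norm_B by (auto simp: pairwise_def orthogonal_def norm_eq_1)

lemma expansion: "(\<Sum>b\<in>B. (b \<bullet> y) *\<^sub>R b) = y"
proof -
  have "0 \<notin> B" using norm_B by fastforce
  then have "independent B"
    using orth_B pairwise_orthogonal_independent by blast
  then have span: "span B = UNIV"
    by (metis card_B dim_eq_card_independent dim_eq_full)
  have "orthogonal ((\<Sum>b\<in>B. (b \<bullet> y) *\<^sub>R b) - y) b" if "b \<in> B" for b
  proof -
    have "(\<Sum>b'\<in>B. (b' \<bullet> y) *\<^sub>R b') \<bullet> b = (\<Sum>b'\<in>B. if b' = b then b' \<bullet> y else 0)"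
      unfolding inner_sum_left using that by (intro sum.cong) (auto simp: inner_B)
    also have "\<dots> = b \<bullet> y" using that by simp
    finally show ?thesis by (simp add: orthogonal_def inner_diff_left inner_commute[of y])
  qed
  then have "orthogonal ((\<Sum>b\<in>B. (b \<bullet> y) *\<^sub>R b) - y) z" for z
    by (intro orthogonal_to_span[of z B]) (use span in auto)
  then show ?thesis
    by (metis orthogonal_self right_minus_eq)
qed

text \<open>The vector with coordinates \<open>1\<close> on \<open>A\<close> and \<open>-1\<close> off \<open>A\<close>; indexing sign vectors by subsets
  of \<open>B\<close> makes their number a cardinality of a power set.\<close>

definition sign_vec :: "'a set \<Rightarrow> 'a" where
  "sign_vec A = (\<Sum>b\<in>B. (if b \<in> A then 1 else - 1) *\<^sub>R b)"

lemma inner_sign_vec: "sign_vec A \<bullet> y = (\<Sum>b\<in>B. (if b \<in> A then 1 else - 1) * (b \<bullet> y))"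
  by (simp add: sign_vec_def inner_sum_left)

lemma sign_vec_inner_B: "b \<in> B \<Longrightarrow> sign_vec A \<bullet> b = (if b \<in> A then 1 else - 1)"
proof -
  assume b: "b \<in> B"
  have "sign_vec A \<bullet> b = (\<Sum>b'\<in>B. if b' = b then (if b \<in> A then 1 else - 1) else 0)"
    unfolding inner_sign_vec using b by (intro sum.cong) (auto simp: inner_B)
  then show ?thesis using b by simp
qed

lemma inner_sign_vec_sign_vec:
  "sign_vec A \<bullet> sign_vec A' = (\<Sum>b\<in>B. if (b \<in> A) = (b \<in> A') then 1 else - 1)"
  unfolding inner_sign_vec[of A] using sign_vec_inner_B[of _ A']
  by (intro sum.cong) (auto simp: inner_commute)

lemma inner_sign_vec_self: "sign_vec A \<bullet> sign_vec A = DIM('a)"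
  by (simp add: inner_sign_vec_sign_vec card_B)

lemma inner_sign_vec_distinct:
  assumes "A \<subseteq> B" "A' \<subseteq> B" "A \<noteq> A'"
  shows "sign_vec A \<bullet> sign_vec A' \<le> real DIM('a) - 2"
proof -
  obtain b where b: "b \<in> B" "(b \<in> A) \<noteq> (b \<in> A')" using assms by blast
  let ?f = "\<lambda>b. if (b \<in> A) = (b \<in> A') then 1 else - 1 :: real"
  have "sum ?f (B - {b}) \<le> (\<Sum>b\<in>B - {b}. 1)" by (intro sum_mono) auto
  also have "\<dots> = real (card B - 1)" using b by simp
  also have "\<dots> = real DIM('a) - 1" using card_B by (simp add: of_nat_diff Suc_leI)
  finally show ?thesis
    unfolding inner_sign_vec_sign_vec using b by (subst sum.remove[of B b]) auto
qed

section \<open>The crosspolytope as the unit ball of the l1-norm\<close>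

definition cross_points :: "'a \<Rightarrow> 'a set" where
  "cross_points c = (+) c ` (B \<union> uminus ` B)"

text \<open>A point satisfying all the sign inequalities satisfies in particular the one for the signs of
  its own coordinates, so its coordinates have absolute sum at most \<open>1\<close>; it is then a convex
  combination of points \<open>\<plusminus>b\<close> and of the center, which is itself a midpoint.\<close>

lemma convex_hull_cross_points_eq:
  "convex hull cross_points c = {x. \<forall>A\<subseteq>B. sign_vec A \<bullet> (x - c) \<le> 1}" (is "_ = ?Q")
proof
  have "?Q = (\<Inter>A\<in>Pow B. {x. sign_vec A \<bullet> x \<le> 1 + sign_vec A \<bullet> c})"
    by (auto simp: inner_diff_right algebra_simps)
  then have "convex ?Q" by (simp only:) (intro convex_INT convex_halfspace_le)
  moreover have "cross_points c \<subseteq> ?Q"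
    by (auto simp: cross_points_def sign_vec_inner_B)
  ultimately show "convex hull cross_points c \<subseteq> ?Q" by (simp add: hull_minimal)
next
  let ?H = "convex hull cross_points c"
  have pts: "c + b \<in> ?H" "c - b \<in> ?H" if "b \<in> B" for b
    using that by (auto simp: cross_points_def intro!: hull_inc)
  obtain b0 where "b0 \<in> B" using B_nonempty by blast
  have "(1/2) *\<^sub>R (c + b0) + (1/2) *\<^sub>R (c - b0) \<in> ?H"
    by (intro convexD[OF convex_convex_hull] pts \<open>b0 \<in> B\<close>) auto
  moreover have "(1/2) *\<^sub>R (c + b0) + (1/2) *\<^sub>R (c - b0) = c"
    by (simp add: algebra_simps flip: scaleR_add_left)
  ultimately have c: "c \<in> ?H" by simp
  show "?Q \<subseteq> ?H"
  proof
    fix x assume x: "x \<in> ?Q"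
    define y where "y = x - c"
    define S where "S = (\<Sum>b\<in>B. \<bar>b \<bullet> y\<bar>)"
    have "S = sign_vec {b\<in>B. b \<bullet> y \<ge> 0} \<bullet> y"
      unfolding S_def inner_sign_vec by (intro sum.cong) auto
    also have "\<dots> \<le> 1" using x by (auto simp: y_def)
    finally have "S \<le> 1" .
    have "S \<ge> 0" by (simp add: S_def sum_nonneg)
    let ?p = "\<lambda>b. c + sgn (b \<bullet> y) *\<^sub>R b"
    have p: "?p b \<in> ?H" if "b \<in> B" for b
      using pts[OF that] c by (simp add: sgn_if)
    have "(\<Sum>b\<in>B. \<bar>b \<bullet> y\<bar> *\<^sub>R ?p b) = (\<Sum>b\<in>B. \<bar>b \<bullet> y\<bar> *\<^sub>R c + (b \<bullet> y) *\<^sub>R b)"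
      by (intro sum.cong refl) (simp add: scaleR_add_right abs_mult_sgn)
    then have sum_p: "(\<Sum>b\<in>B. \<bar>b \<bullet> y\<bar> *\<^sub>R ?p b) = S *\<^sub>R c + y"
      by (simp add: sum.distrib expansion S_def scaleR_left.sum)
    show "x \<in> ?H"
    proof (cases "S = 0")
      case True
      then have "y = 0" using sum_p by (simp add: S_def sum_nonneg_eq_0_iff)
      then show ?thesis using c by (simp add: y_def)
    next
      case False
      have "(\<Sum>b\<in>B. (\<bar>b \<bullet> y\<bar> / S) *\<^sub>R ?p b) \<in> ?H"
        using False \<open>S \<ge> 0\<close> p
        by (intro convex_sum) (auto simp: S_def simp flip: sum_divide_distrib)
      then have "S *\<^sub>R (\<Sum>b\<in>B. (\<bar>b \<bullet> y\<bar> / S) *\<^sub>R ?p b) + (1 - S) *\<^sub>R c \<in> ?H"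
        using \<open>S \<ge> 0\<close> \<open>S \<le> 1\<close> by (intro convexD[OF convex_convex_hull] c) auto
      also have "S *\<^sub>R (\<Sum>b\<in>B. (\<bar>b \<bullet> y\<bar> / S) *\<^sub>R ?p b) = (\<Sum>b\<in>B. \<bar>b \<bullet> y\<bar> *\<^sub>R ?p b)"
        using False unfolding scaleR_sum_right by (intro sum.cong) auto
      also have "\<dots> + (1 - S) *\<^sub>R c = x"
        unfolding sum_p by (simp add: y_def algebra_simps)
      finally show ?thesis .
    qed
  qed
qed

section \<open>Counting the facets\<close>

text \<open>Two points on the ray from the center along a sign vector \<open>w\<close> do the work. The multiple
  \<open>w / n\<close> satisfies the inequality of \<open>w\<close> with equality and all the others strictly, which
  separates the facets; the multiple \<open>w / (n - 1/2)\<close> violates only the inequality of \<open>w\<close>,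
  which shows irredundancy.\<close>

lemma card_facets_cross: "card {f. f facet_of convex hull cross_points c} = 2 ^ DIM('a)"
proof -
  let ?P = "convex hull cross_points c"
  let ?n = "real DIM('a)"
  define H where "H A = {x. sign_vec A \<bullet> x \<le> 1 + sign_vec A \<bullet> c}" for A
  have n: "?n \<ge> 1" by (simp add: Suc_leI)
  have H_iff: "x \<in> H A \<longleftrightarrow> sign_vec A \<bullet> (x - c) \<le> 1" for x A
    by (auto simp: H_def inner_diff_right)
  have P_eq: "?P = \<Inter>(H ` Pow B)"
    by (auto simp: convex_hull_cross_points_eq H_iff)
  have full: "affine hull ?P = UNIV"
  proof -
    \<comment> \<open>A sign vector has norm at most \<open>n\<close> (indeed \<open>\<surd>n\<close>), so \<open>P\<close> contains a ball of
      radius \<open>1 / n\<close> and is full-dimensional.\<close>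
    have "ball c (1 / ?n) \<subseteq> ?P"
    proof
      fix x assume x: "x \<in> ball c (1 / ?n)"
      have "sign_vec A \<bullet> (x - c) \<le> 1" for A
      proof -
        have "norm (sign_vec A) \<le> (\<Sum>b\<in>B. norm ((if b \<in> A then 1 else - 1 :: real) *\<^sub>R b))"
          unfolding sign_vec_def by (rule norm_sum)
        also have "\<dots> = (\<Sum>b\<in>B. 1)" by (intro sum.cong) (auto simp: norm_B)
        finally have "norm (sign_vec A) \<le> ?n" by (simp add: card_B)
        moreover have "norm (x - c) \<le> 1 / ?n" using x by (simp add: dist_norm norm_minus_commute)
        ultimately have "norm (sign_vec A) * norm (x - c) \<le> ?n * (1 / ?n)"
          by (intro mult_mono) auto
        then show ?thesis using norm_cauchy_schwarz[of "sign_vec A" "x - c"] n by simp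
      qed
      then show "x \<in> ?P" by (simp add: convex_hull_cross_points_eq)
    qed
    then have "interior ?P \<noteq> {}"
      using n by (metis centre_in_ball empty_iff interior_maximal open_ball subsetD
          zero_less_divide_1_iff zero_less_one order_less_le_trans)
    then show ?thesis by (rule affine_hull_nonempty_interior)
  qed
  have pos: "?n - 1/2 > 0" using n by linarith
  \<comment> \<open>Any factor strictly between \<open>1 / n\<close> and \<open>1 / (n - 2)\<close> would do when \<open>n > 2\<close>;
    this one also works for \<open>n \<le> 2\<close>.\<close>
  define z where "z A = c + (1 / (?n - 1/2)) *\<^sub>R sign_vec A" for A
  have only: "z A \<in> H A' \<longleftrightarrow> A' \<noteq> A" if "A \<subseteq> B" "A' \<subseteq> B" for A A'
  proof (cases "A' = A")
    case True
    have "?n / (?n - 1/2) > 1" using pos by (subst less_divide_eq_1_pos) auto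
    then show ?thesis using True by (simp add: z_def H_iff inner_sign_vec_self)
  next
    case False
    have "(sign_vec A' \<bullet> sign_vec A) / (?n - 1/2) \<le> 1"
      using inner_sign_vec_distinct[of A' A] that False pos by (subst divide_le_eq_1_pos) linarith+
    then show ?thesis using False by (simp add: z_def H_iff)
  qed
  have inj: "inj_on H (Pow B)"
  proof (rule inj_onI)
    fix A A' assume "A \<in> Pow B" "A' \<in> Pow B" "H A = H A'"
    then show "A = A'" using only by (metis PowD)
  qed
  define idx where "idx = inv_into (Pow B) H"
  have idx: "idx (H A) = A" if "A \<subseteq> B" for A
    using that inj by (simp add: idx_def)
  have facets: "f facet_of ?P \<longleftrightarrow>
      (\<exists>h. h \<in> H ` Pow B \<and> f = ?P \<inter> {x. sign_vec (idx h) \<bullet> x = 1 + sign_vec (idx h) \<bullet> c})" for f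
  proof (rule facet_of_polyhedron_explicit)
    show "finite (H ` Pow B)" by simp
    show "?P = affine hull ?P \<inter> \<Inter>(H ` Pow B)" unfolding full Int_UNIV_left by (rule P_eq)
    fix h assume "h \<in> H ` Pow B"
    then obtain A where A: "A \<subseteq> B" "h = H A" by blast
    moreover have "sign_vec A \<noteq> 0" using inner_sign_vec_self[of A] by auto
    ultimately show "sign_vec (idx h) \<noteq> 0 \<and> h = {x. sign_vec (idx h) \<bullet> x \<le> 1 + sign_vec (idx h) \<bullet> c}"
      by (simp add: idx) (simp add: H_def)
  next
    fix F' assume F': "F' \<subset> H ` Pow B"
    then obtain A where A: "A \<subseteq> B" "H A \<notin> F'" by blast
    have "z A \<in> h" if "h \<in> F'" for h
    proof -
      from psubsetD[OF F' that] obtain A' where A': "A' \<subseteq> B" "h = H A'" by blast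
      then have "A' \<noteq> A" using that A(2) by metis
      then show ?thesis using only[OF A(1) A'(1)] A'(2) by simp
    qed
    then have "z A \<in> \<Inter>F'" by simp
    moreover have "z A \<notin> \<Inter>(H ` Pow B)"
      using A(1) only[OF A(1) A(1)] by blast
    moreover have "\<Inter>(H ` Pow B) \<subseteq> \<Inter>F'"
      by (rule Inter_anti_mono[OF psubset_imp_subset[OF F']])
    ultimately show "?P \<subset> affine hull ?P \<inter> \<Inter>F'"
      unfolding full Int_UNIV_left unfolding P_eq psubset_eq by metis
  qed
  define G where "G A = ?P \<inter> {x. sign_vec A \<bullet> x = 1 + sign_vec A \<bullet> c}" for A
  have eq: "{f. f facet_of ?P} = G ` Pow B"
    by (auto simp: facets idx G_def)
  define p where "p A = c + (1 / ?n) *\<^sub>R sign_vec A" for A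
  have p: "sign_vec A' \<bullet> (p A - c) = (sign_vec A' \<bullet> sign_vec A) / ?n" for A A'
    by (simp add: p_def)
  have on_facet: "p A \<in> G A' \<longleftrightarrow> A' = A" if "A \<subseteq> B" "A' \<subseteq> B" for A A'
  proof -
    have lt: "sign_vec A'' \<bullet> (p A - c) < 1" if "A'' \<subseteq> B" "A'' \<noteq> A" for A''
      unfolding p using inner_sign_vec_distinct[OF that(1) \<open>A \<subseteq> B\<close> that(2)] n
      by (subst divide_less_eq_1_pos) linarith+
    have self: "sign_vec A \<bullet> (p A - c) = 1"
      unfolding p by (simp add: inner_sign_vec_self)
    have "\<forall>A''\<subseteq>B. sign_vec A'' \<bullet> (p A - c) \<le> 1"
      using lt self by (metis less_eq_real_def)
    then have "p A \<in> ?P" by (simp add: convex_hull_cross_points_eq)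
    then have "p A \<in> G A' \<longleftrightarrow> sign_vec A' \<bullet> (p A - c) = 1"
      by (auto simp: G_def inner_diff_right)
    then show ?thesis using lt[OF that(2)] self by fastforce
  qed
  have "inj_on G (Pow B)"
  proof (rule inj_onI)
    fix A A' assume "A \<in> Pow B" "A' \<in> Pow B" "G A = G A'"
    then show "A = A'" using on_facet by (metis PowD)
  qed
  then show ?thesis
    by (simp add: eq card_image card_Pow card_B)
qed

section \<open>Vertices and their distances\<close>

lemma cross_pointsE:
  assumes "x \<in> cross_points c"
  obtains b s where "b \<in> B" "x = c + s *\<^sub>R b" "s = 1 \<or> s = - 1"
proof -
  from assms obtain b where "b \<in> B" "x = c + b \<or> x = c - b"
    by (auto simp: cross_points_def)
  then show thesis using that[of b 1] that[of b "- 1"] by auto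
qed

lemma card_cross_points: "card (cross_points c) = 2 * DIM('a)"
proof -
  have "b \<noteq> - b'" if "b \<in> B" "b' \<in> B" for b b'
  proof
    assume "b = - b'"
    then have "b \<bullet> b' = - 1" using inner_B[OF that(2) that(2)] by simp
    then show False using inner_B[OF that] by (simp split: if_splits)
  qed
  then have "B \<inter> uminus ` B = {}" by blast
  then show ?thesis
    by (simp add: cross_points_def card_image card_Un_disjoint card_B)
qed

text \<open>Distinct, non-antipodal points lie in orthogonal unit directions, so their squared distance
  is \<open>1 + 1\<close>.\<close>

lemma prod_dist_cross_points:
  assumes u: "u \<in> cross_points c"
  shows "(\<Prod>v\<in>cross_points c - {u}. (dist u v)\<^sup>2) = (2 ^ DIM('a))\<^sup>2"
proof -
  let ?u' = "c - (u - c)"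
  let ?R = "cross_points c - {u} - {?u'}"
  obtain b s where b: "b \<in> B" "u = c + s *\<^sub>R b" "s = 1 \<or> s = - 1"
    using u by (rule cross_pointsE)
  have "?u' \<in> cross_points c"
    using b by (auto simp: cross_points_def)
  moreover have "u - ?u' = (2 * s) *\<^sub>R b"
    using b by (auto simp: algebra_simps scaleR_2)
  then have d: "dist u ?u' = 2" using b norm_B by (auto simp: dist_norm)
  ultimately have u': "?u' \<in> cross_points c - {u}" by force
  have fin: "finite (cross_points c)" by (simp add: cross_points_def)
  have "(dist u v)\<^sup>2 = 2" if "v \<in> ?R" for v
  proof -
    have "v \<in> cross_points c" using that by simp
    then obtain b' t where b': "b' \<in> B" "v = c + t *\<^sub>R b'" "t = 1 \<or> t = - 1"
      by (rule cross_pointsE)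
    have "u \<noteq> v" "?u' \<noteq> v" using that by auto
    then have "b' \<noteq> b" using b b' by auto
    then have "(s *\<^sub>R b) \<bullet> (t *\<^sub>R b') = 0" "(s *\<^sub>R b) \<bullet> (s *\<^sub>R b) = 1" "(t *\<^sub>R b') \<bullet> (t *\<^sub>R b') = 1"
      using b b' inner_B by auto
    moreover have "(dist u v)\<^sup>2 = (s *\<^sub>R b - t *\<^sub>R b') \<bullet> (s *\<^sub>R b - t *\<^sub>R b')"
      using b b' by (simp add: dist_norm power2_norm_eq_inner)
    ultimately show ?thesis by (auto simp: inner_diff inner_commute)
  qed
  then have "(\<Prod>v\<in>?R. (dist u v)\<^sup>2) = 2 ^ card ?R" by simp
  moreover have "card ?R = 2 * (DIM('a) - 1)"
    using u u' fin card_cross_points[of c] by (simp add: card_Diff_singleton)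
  ultimately have "(\<Prod>v\<in>cross_points c - {u}. (dist u v)\<^sup>2) = 2 ^ 2 * 2 ^ (2 * (DIM('a) - 1))"
    using fin u' d by (subst prod.remove[of _ ?u']) auto
  also have "\<dots> = 2 ^ (2 * DIM('a))"
    by (cases "DIM('a)") (simp_all add: power_add)
  finally show ?thesis by (simp add: power_even_eq)
qed

end

text \<open>Points of a sphere are extreme in any convex hull of points of that sphere, because Euclidean
  balls are strictly convex.\<close>

lemma vertices_convex_hull_sphere:
  fixes X :: "'a::euclidean_space set"
  assumes "X \<subseteq> sphere c r"
  shows "vertices (convex hull X) = X"
proof
  show "vertices (convex hull X) \<subseteq> X"
    unfolding vertices_def by (rule extreme_points_of_convex_hull)
  show "X \<subseteq> vertices (convex hull X)"
  proof
    fix x assume x: "x \<in> X"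
    have sub: "convex hull X \<subseteq> cball c r"
      using assms by (intro hull_minimal) auto
    have "x \<notin> open_segment a b" if "a \<in> convex hull X" "b \<in> convex hull X" for a b
    proof
      assume o: "x \<in> open_segment a b"
      then have "dist c x < r"
        using sub that dist_decreases_open_segment[OF o, of c] by force
      then show False using x assms by auto
    qed
    then show "x \<in> vertices (convex hull X)"
      using x by (auto simp: vertices_def extreme_point_of_def hull_inc)
  qed
qed

section \<open>Chords\<close>

text \<open>A product over unordered pairs is accessible through ordered pairs: the chord with ends
  \<open>u\<close> and \<open>v\<close> arises from exactly the two pairs \<open>(u, v)\<close> and \<open>(v, u)\<close>.\<close>

lemma prod_chords_squared:
  fixes P :: "'a::euclidean_space set" and f :: "'a set \<Rightarrow> real"
  assumes fin: "finite (vertices P)"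
  shows "(\<Prod>s\<in>chords P. f s)\<^sup>2 =
    (\<Prod>u\<in>vertices P. \<Prod>v\<in>vertices P - {u}. f (closed_segment u v))"
proof -
  let ?V = "vertices P"
  let ?S = "SIGMA u:?V. ?V - {u}"
  let ?g = "\<lambda>(u, v). closed_segment u v"
  have finS: "finite ?S" using fin by auto
  have im: "?g ` ?S = chords P"
    by (auto simp: chords_def image_iff)
  have "(\<Prod>u\<in>?V. \<Prod>v\<in>?V - {u}. f (closed_segment u v)) = (\<Prod>z\<in>?S. f (?g z))"
    using fin by (simp add: prod.Sigma case_prod_unfold)
  also have "\<dots> = (\<Prod>s\<in>chords P. \<Prod>z\<in>{z\<in>?S. ?g z = s}. f (?g z))"
    using prod.image_gen[OF finS, of "\<lambda>z. f (?g z)" ?g] by (simp only: im)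
  also have "\<dots> = (\<Prod>s\<in>chords P. (f s)\<^sup>2)"
  proof (rule prod.cong[OF refl])
    fix s assume "s \<in> chords P"
    then obtain u v where uv: "u \<in> ?V" "v \<in> ?V" "u \<noteq> v" "s = closed_segment u v"
      by (auto simp: chords_def)
    then have "{z\<in>?S. ?g z = s} = {(u, v), (v, u)}"
      by (auto simp: doubleton_eq_iff closed_segment_commute)
    then show "(\<Prod>z\<in>{z\<in>?S. ?g z = s}. f (?g z)) = (f s)\<^sup>2"
      using uv by (simp add: power2_eq_square closed_segment_commute[of v u])
  qed
  finally show ?thesis by (simp add: prod_power_distrib)
qed

section \<open>The chord product\<close>

text \<open>Normalizing the given directions produces an orthonormal basis. The circumradius equals \<open>1\<close>
  because the points spanning \<open>P\<close> are its vertices.\<close>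

lemma unit_regular_crosspolytopeE:
  fixes P :: "(real^'n) set"
  assumes "regular_crosspolytope c P" and "vertices P \<subseteq> sphere c 1"
  obtains B where "orthonormal_basis B"
    "P = convex hull orthonormal_basis.cross_points B c"
    "vertices P = orthonormal_basis.cross_points B c"
proof -
  obtain D r where D: "card D = CARD('n)" "0 \<notin> D" "pairwise orthogonal D" "r > 0"
    and P: "P = convex hull {x. dist c x = r \<and> (\<exists>d\<in>D. x \<in> affine hull {c, c + d})}"
    using assms(1) unfolding regular_crosspolytope_def by blast
  let ?X = "{x. dist c x = r \<and> (\<exists>d\<in>D. x \<in> affine hull {c, c + d})}"
  have V: "vertices P = ?X"
    unfolding P by (rule vertices_convex_hull_sphere[of _ c r]) auto
  have X_iff: "x \<in> ?X \<longleftrightarrow> (\<exists>d\<in>D. x = c + r *\<^sub>R sgn d \<or> x = c - r *\<^sub>R sgn d)" (is "_ \<longleftrightarrow> ?rhs") for x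
  proof
    assume "x \<in> ?X"
    then obtain d t where d: "d \<in> D" "x = c + t *\<^sub>R d" "dist c x = r"
      by (auto simp: affine_hull_2_alt)
    then have "\<bar>t\<bar> * norm d = r" by (simp add: dist_norm)
    moreover have "norm d \<noteq> 0" using d D(2) by auto
    ultimately have "t *\<^sub>R d = r *\<^sub>R sgn d \<or> t *\<^sub>R d = - (r *\<^sub>R sgn d)"
      by (cases "t \<ge> 0") (auto simp: sgn_div_norm)
    then show ?rhs using d by auto
  next
    assume ?rhs
    then obtain d where d: "d \<in> D" "x = c + r *\<^sub>R sgn d \<or> x = c - r *\<^sub>R sgn d" by blast
    then have "d \<noteq> 0" using D by auto
    have "x = c + (r / norm d) *\<^sub>R d \<or> x = c + (- r / norm d) *\<^sub>R d"
      using d by (auto simp: sgn_div_norm divide_inverse)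
    then have "x \<in> affine hull {c, c + d}"
      unfolding affine_hull_2_alt add_diff_cancel_left' by blast
    moreover have "dist c x = r"
      using d D(4) \<open>d \<noteq> 0\<close> by (auto simp: dist_norm norm_sgn)
    ultimately show "x \<in> ?X" using d by blast
  qed
  have "D \<noteq> {}" using D(1) by force
  then have "?X \<noteq> {}" using X_iff by blast
  moreover have "?X \<subseteq> sphere c 1" using assms(2) V by simp
  ultimately have "r = 1" by fastforce
  have inner_D: "d \<bullet> d' = 0" if "d \<in> D" "d' \<in> D" "d \<noteq> d'" for d d'
    using D(3) that by (auto simp: pairwise_def orthogonal_def)
  have inner_sgn: "sgn d \<bullet> sgn d' = 0" if "d \<in> D" "d' \<in> D" "d \<noteq> d'" for d d'
    using inner_D[OF that] by (simp add: sgn_div_norm)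
  have inj: "inj_on sgn D"
  proof (rule inj_onI, rule ccontr)
    fix d d' assume d: "d \<in> D" "d' \<in> D" "sgn d = sgn d'" "d \<noteq> d'"
    then have "sgn d \<bullet> sgn d = 0" using inner_sgn[of d d'] by simp
    then show False using d D(2) by (auto simp: sgn_zero_iff)
  qed
  interpret orthonormal_basis "sgn ` D"
  proof
    show "card (sgn ` D) = DIM(real^'n)" using inj D(1) by (simp add: card_image)
    show "pairwise orthogonal (sgn ` D)"
      using inner_sgn by (force simp: pairwise_def orthogonal_def)
    show "norm b = 1" if "b \<in> sgn ` D" for b
      using that D(2) by (auto simp: norm_sgn)
  qed
  have "?X = cross_points c"
    using X_iff \<open>r = 1\<close> by (fastforce simp: cross_points_def)
  then show thesis
    using that[OF orthonormal_basis_axioms] P V by simp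
qed

theorem theorem5p1:
  fixes P :: "(real^'n) set" and ctr :: "real^'n"
  assumes "CARD('n) \<ge> 2"
    and "regular_crosspolytope ctr P"
    and "vertices P \<subseteq> sphere ctr 1"
  shows "(\<Prod>s\<in>chords P. (segment_length s)\<^sup>2) = real (card (facets P)) ^ card (vertices P)"
proof -
  obtain B where B: "orthonormal_basis B"
    and P: "P = convex hull orthonormal_basis.cross_points B ctr"
    and V: "vertices P = orthonormal_basis.cross_points B ctr"
    using unit_regular_crosspolytopeE[OF assms(2,3)] .
  interpret orthonormal_basis B by fact
  have fin: "finite (vertices P)" by (simp add: V cross_points_def)
  have F: "card (facets P) = 2 ^ CARD('n)"
    using card_facets_cross[of ctr] by (simp add: facets_def P)
  have "(\<Prod>s\<in>chords P. (segment_length s)\<^sup>2)\<^sup>2 =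
      (\<Prod>u\<in>vertices P. \<Prod>v\<in>vertices P - {u}. (dist u v)\<^sup>2)"
    by (simp add: prod_chords_squared[OF fin])
  also have "\<dots> = (\<Prod>u\<in>vertices P. (real (card (facets P)))\<^sup>2)"
    by (intro prod.cong refl) (simp add: V F prod_dist_cross_points)
  also have "\<dots> = (real (card (facets P)) ^ card (vertices P))\<^sup>2"
    by (simp add: power_commutes flip: power_mult) (simp add: mult.commute)
  finally show ?thesis
    by (rule power2_eq_imp_eq) (auto intro!: prod_nonneg)
qed

end
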